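(* In the stochastic unbounded min-knapsack problem described in the context, let $OPT^{(b)}_W$ be the minimum expected cost of a block strategy. Then \[OPT_W\le OPT^{(b)}_W\le OPT_W+\frac{\epsilon T}{5}.\]
   Context: Fix integers $n\ge1$, $W\ge1$ and $\epsilon\in(0,1)$. There are $n$ item types; type $i$ has a deterministic cost $c_i>0$ and a random weight $X_i$ with known distribution supported in $\{1,\dots,W\}$ (standing assumption). Infinitely many items of each type, all weights independent; items are inserted one at a time with weights revealed upon insertion, and a strategy adaptively chooses what to insert until the total weight is at least $W$. $OPT_W$ denotes the minimum expected total cost over all strategies (equivalently $OPT_w=0$ for $w\le 0$ and $OPT_w=\min_j(c_j+\sum_{k=1}^W\Pr[X_j=k]OPT_{w-k})$ for $1\le w\le W$). Let $\bar E[X_i]=\sum_{j=1}^W\Pr[X_i=j]2^{\lfloor\log_2j\rfloor}$, $T=\frac W2\min_i\frac{c_i}{\bar E[X_i]}$ and $\theta=\frac{\epsilon}{10n}$. For each type $p$: if $c_p\ge\theta T$ let $e_p=1$; otherwise let $e_p=2^{k_p}$ for an integer $k_p$ such that $e_pc_p\in[\theta T,2\theta T]$. A block strategy is a strategy in which, for every type $p$, items of type $p$ are always inserted a multiple of $e_p$ at a time, all together (no decision is taken between the items of such a group; the group is completed even if the total weight reaches $W$ in the middle of it). *)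

theory Defs
  imports "HOL-Probability.Probability"
begin

text \<open>
  Item types are the indices \<open>p < n\<close>; \<open>c p\<close> is the cost and \<open>X p\<close> the weight distribution of
  type \<open>p\<close>. A history lists the (type, weight) pairs of the items inserted so far, oldest first.
  A strategy maps the current history to a pair \<open>(p, m)\<close>: insert \<open>m\<close> items of type \<open>p\<close> all
  together, the next decision being taken only after all \<open>m\<close> weights have been revealed.
\<close>

type_synonym history = "(nat \<times> nat) list"
type_synonym strategy = "history \<Rightarrow> nat \<times> nat"

definition total_weight :: "history \<Rightarrow> nat" where
  "total_weight h = (\<Sum>(p, w)\<leftarrow>h. w)"

definition total_cost :: "(nat \<Rightarrow> real) \<Rightarrow> history \<Rightarrow> real" where
  "total_cost c h = (\<Sum>(p, w)\<leftarrow>h. c p)"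

definition insert_items :: "(nat \<Rightarrow> nat pmf) \<Rightarrow> history \<Rightarrow> nat \<times> nat \<Rightarrow> history pmf" where
  "insert_items X h = (\<lambda>(p, m). map_pmf (\<lambda>ws. h @ map (Pair p) ws) (replicate_pmf m (X p)))"

text \<open>
  Distribution of the history after at most \<open>t\<close> decisions. No decision is taken once the total
  weight is at least \<open>W\<close>, but a group that has been started is always inserted (and paid for)
  completely.
\<close>

primrec run :: "nat \<Rightarrow> (nat \<Rightarrow> nat pmf) \<Rightarrow> strategy \<Rightarrow> nat \<Rightarrow> history pmf" where
  "run W X \<sigma> 0 = return_pmf []"
| "run W X \<sigma> (Suc t) = bind_pmf (run W X \<sigma> t)
     (\<lambda>h. if W \<le> total_weight h then return_pmf h else insert_items X h (\<sigma> h))"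

text \<open>
  If weights are at least 1 and every decision inserts at least one item, \<open>W\<close> decisions always
  suffice to reach total weight \<open>W\<close> (lemma \<open>run_finished\<close> below), so \<open>run W X \<sigma> W\<close> is the
  distribution of the final history.
\<close>

definition expected_cost ::
    "nat \<Rightarrow> (nat \<Rightarrow> real) \<Rightarrow> (nat \<Rightarrow> nat pmf) \<Rightarrow> strategy \<Rightarrow> real" where
  "expected_cost W c X \<sigma> = measure_pmf.expectation (run W X \<sigma> W) (total_cost c)"

definition item_strategies :: "nat \<Rightarrow> strategy set" where
  "item_strategies n = {\<sigma>. \<forall>h. \<exists>p<n. \<sigma> h = (p, 1)}"

definition block_strategies :: "nat \<Rightarrow> (nat \<Rightarrow> nat) \<Rightarrow> strategy set" where
  "block_strategies n e = {\<sigma>. \<forall>h. \<exists>p<n. \<exists>k>0. \<sigma> h = (p, k * e p)}"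

text \<open>
  The sets of expected costs below are nonempty and bounded below by 0 (for \<open>n \<ge> 1\<close> and positive
  costs), and their infima are minima: the dynamic-programming recursion over the remaining weight
  yields optimal strategies.
\<close>

definition OPT :: "nat \<Rightarrow> nat \<Rightarrow> (nat \<Rightarrow> real) \<Rightarrow> (nat \<Rightarrow> nat pmf) \<Rightarrow> real" where
  "OPT n W c X = (INF \<sigma>\<in>item_strategies n. expected_cost W c X \<sigma>)"

definition block_OPT ::
    "nat \<Rightarrow> nat \<Rightarrow> (nat \<Rightarrow> real) \<Rightarrow> (nat \<Rightarrow> nat pmf) \<Rightarrow> (nat \<Rightarrow> nat) \<Rightarrow> real" where
  "block_OPT n W c X e = (INF \<sigma>\<in>block_strategies n e. expected_cost W c X \<sigma>)"

definition Ebar :: "nat \<Rightarrow> nat pmf \<Rightarrow> real" where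
  "Ebar W D = (\<Sum>j=1..W. pmf D j * 2 powi \<lfloor>log 2 (real j)\<rfloor>)"

definition T_val :: "nat \<Rightarrow> nat \<Rightarrow> (nat \<Rightarrow> real) \<Rightarrow> (nat \<Rightarrow> nat pmf) \<Rightarrow> real" where
  "T_val n W c X = real W / 2 * (MIN i\<in>{..<n}. c i / Ebar W (X i))"

definition theta :: "nat \<Rightarrow> real \<Rightarrow> real" where
  "theta n \<epsilon> = \<epsilon> / (10 * real n)"

text \<open>
  In the second case the exponent need not be unique (if \<open>\<theta> * T / c p\<close> is a power of two, there
  are two choices); every admissible choice is allowed. It is automatically positive.
\<close>

definition valid_block_sizes ::
    "nat \<Rightarrow> nat \<Rightarrow> real \<Rightarrow> (nat \<Rightarrow> real) \<Rightarrow> (nat \<Rightarrow> nat pmf) \<Rightarrow> (nat \<Rightarrow> nat) \<Rightarrow> bool" where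
  "valid_block_sizes n W \<epsilon> c X e \<longleftrightarrow>
     (let \<theta> = theta n \<epsilon>; T = T_val n W c X in
      \<forall>p<n. if c p \<ge> \<theta> * T then e p = 1
            else (\<exists>k::int. real (e p) = 2 powi k) \<and>
                 real (e p) * c p \<in> {\<theta> * T..2 * \<theta> * T})"

lemma total_weight_run:
  assumes X: "\<And>p. p < n \<Longrightarrow> set_pmf (X p) \<subseteq> {1..W}"
    and \<sigma>: "\<And>h. \<exists>p<n. \<exists>m>0. \<sigma> h = (p, m)"
    and "h \<in> set_pmf (run W X \<sigma> t)"
  shows "min t W \<le> total_weight h"
  using assms(3)
proof (induction t arbitrary: h)
  case (Suc t)
  then obtain h' where h': "h' \<in> set_pmf (run W X \<sigma> t)"
    and h: "h \<in> set_pmf (if W \<le> total_weight h' then return_pmf h' else insert_items X h' (\<sigma> h'))"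
    by auto
  show ?case
  proof (cases "W \<le> total_weight h'")
    case True
    then show ?thesis using h by simp
  next
    case False
    obtain p m where pm: "p < n" "m > 0" "\<sigma> h' = (p, m)" using \<sigma> by blast
    then obtain ws where ws: "h = h' @ map (Pair p) ws" "length ws = m" "set ws \<subseteq> set_pmf (X p)"
      using h False by (auto simp: insert_items_def set_replicate_pmf)
    have "length ws \<le> sum_list ws"
      using ws(3) X[OF pm(1)] by (induction ws) force+
    then have "total_weight h \<ge> total_weight h' + 1"
      using ws pm(2) by (simp add: total_weight_def o_def)
    then show ?thesis using Suc.IH[OF h'] by simp
  qed
qed simp

lemma run_finished:
  assumes "\<And>p. p < n \<Longrightarrow> set_pmf (X p) \<subseteq> {1..W}"
    and "\<And>h. \<exists>p<n. \<exists>m>0. \<sigma> h = (p, m)"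
    and "h \<in> set_pmf (run W X \<sigma> W)"
  shows "W \<le> total_weight h"
  using total_weight_run[of n X W \<sigma> h W] assms by simp

end

theory Submission
  imports Defs
begin

text \<open>
  Both optima are compared through dynamic programs over the remaining weight: \<open>dp m w\<close> is the
  least expected cost of covering the weight \<open>w\<close> when items of type \<open>p\<close> come in groups of exactly
  \<open>m p\<close>. The lower bound holds because a group of items can be inserted one by one.

  For the upper bound, an optimal item strategy is simulated by opening a group of type \<open>p\<close> only
  when no item of type \<open>p\<close> from an earlier group is left unused. As the decisions of the simulated
  strategy do not depend on the weights of the unused items, these may be regarded as still
  random. By induction on the remaining weight of the simulation, the expected cost then exceeds
  the optimum by at most the cost of the items that are bought and left over, that is, by at most
  \<open>(e p - 1) * c p \<le> 2 * \<theta> * T\<close> per type.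
\<close>

section \<open>Expectations over finitely supported distributions\<close>

lemma expectation_bind_pmf_finite:
  fixes h :: "'b \<Rightarrow> real"
  assumes "finite (set_pmf p)" "\<And>x. x \<in> set_pmf p \<Longrightarrow> finite (set_pmf (f x))"
  shows "measure_pmf.expectation (bind_pmf p f) h
       = measure_pmf.expectation p (\<lambda>x. measure_pmf.expectation (f x) h)"
  using assms by (subst pmf_expectation_bind[of "set_pmf p"])
    (auto simp: integral_measure_pmf[of "set_pmf p" p])

lemma expectation_mono_finite:
  fixes f g :: "'a \<Rightarrow> real"
  assumes "finite (set_pmf p)" "\<And>x. x \<in> set_pmf p \<Longrightarrow> f x \<le> g x"
  shows "measure_pmf.expectation p f \<le> measure_pmf.expectation p g"
  using assms by (intro integral_mono_AE integrable_measure_pmf_finite) (auto simp: AE_measure_pmf_iff)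

lemma expectation_cong_pmf:
  fixes f g :: "'a \<Rightarrow> real"
  assumes "\<And>x. x \<in> set_pmf p \<Longrightarrow> f x = g x"
  shows "measure_pmf.expectation p f = measure_pmf.expectation p g"
  using assms by (intro integral_cong_AE) (auto simp: AE_measure_pmf_iff)

lemma expectation_add_const_finite:
  fixes f :: "'a \<Rightarrow> real"
  assumes "finite (set_pmf p)"
  shows "measure_pmf.expectation p (\<lambda>x. a + f x) = a + measure_pmf.expectation p f"
  using assms by (subst Bochner_Integration.integral_add)
    (auto intro: integrable_measure_pmf_finite)

lemma finite_set_replicate_pmf:
  "finite (set_pmf D) \<Longrightarrow> finite (set_pmf (replicate_pmf m D))"
  by (induction m) auto

section \<open>Total weight of a list of independent items\<close>

primrec weight_sum :: "(nat \<Rightarrow> nat pmf) \<Rightarrow> nat list \<Rightarrow> nat pmf" where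
  "weight_sum X [] = return_pmf 0"
| "weight_sum X (p # L) = bind_pmf (X p) (\<lambda>x. map_pmf ((+) x) (weight_sum X L))"

lemma weight_sum_append:
  "weight_sum X (L @ L') = bind_pmf (weight_sum X L) (\<lambda>s. map_pmf ((+) s) (weight_sum X L'))"
  by (induction L)
    (simp_all add: bind_return_pmf map_pmf_def bind_assoc_pmf add.assoc bind_return_pmf')

lemma weight_sum_swap: "weight_sum X (p # q # L) = weight_sum X (q # p # L)"
  by (simp add: map_pmf_def bind_assoc_pmf bind_return_pmf add.left_commute
      bind_commute_pmf[of "X p" "X q"])

lemma weight_sum_remove1:
  "p \<in> set L \<Longrightarrow> weight_sum X L = weight_sum X (p # remove1 p L)"
proof (induction L)
  case (Cons q L)
  show ?case
  proof (cases "q = p")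
    case False
    then have "weight_sum X (q # L) = weight_sum X (q # p # remove1 p L)"
      using Cons by simp
    also have "\<dots> = weight_sum X (p # q # remove1 p L)"
      by (rule weight_sum_swap)
    finally show ?thesis using False by simp
  qed simp
qed simp

lemma weight_sum_replicate:
  "weight_sum X (replicate m p) = map_pmf sum_list (replicate_pmf m (X p))"
  by (induction m) (simp_all add: map_pmf_def bind_assoc_pmf bind_return_pmf)

section \<open>The instance and the dynamic program for fixed group sizes\<close>

locale min_knapsack =
  fixes n W :: nat and c :: "nat \<Rightarrow> real" and X :: "nat \<Rightarrow> nat pmf"
  assumes n_pos: "n \<ge> 1"
    and c_pos: "\<And>p. p < n \<Longrightarrow> c p > 0"
    and supp: "\<And>p. p < n \<Longrightarrow> set_pmf (X p) \<subseteq> {1..W}"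
begin

abbreviation sum_exp :: "nat list \<Rightarrow> (nat \<Rightarrow> real) \<Rightarrow> real" where
  "sum_exp L \<equiv> measure_pmf.expectation (weight_sum X L)"

lemma finite_supp: "p < n \<Longrightarrow> finite (set_pmf (X p))"
  using supp finite_subset by blast

lemma finite_weight_sum: "set L \<subseteq> {..<n} \<Longrightarrow> finite (set_pmf (weight_sum X L))"
  by (induction L) (auto simp: finite_supp)

lemma weight_sum_ge_length:
  "set L \<subseteq> {..<n} \<Longrightarrow> s \<in> set_pmf (weight_sum X L) \<Longrightarrow> length L \<le> s"
proof (induction L arbitrary: s)
  case (Cons p L)
  then obtain x r where "x \<in> set_pmf (X p)" "r \<in> set_pmf (weight_sum X L)" "s = x + r"
    by auto
  moreover have "1 \<le> x" using \<open>x \<in> set_pmf (X p)\<close> supp[of p] Cons.prems by auto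
  moreover have "length L \<le> r" using Cons calculation(2) by auto
  ultimately show ?case by simp
qed simp

lemma sum_exp_append:
  assumes "set L \<subseteq> {..<n}" "set L' \<subseteq> {..<n}"
  shows "sum_exp (L @ L') f = sum_exp L (\<lambda>s. sum_exp L' (\<lambda>s'. f (s + s')))"
  using assms
  by (simp add: weight_sum_append expectation_bind_pmf_finite finite_weight_sum)

lemma sum_exp_Cons:
  assumes "p < n" "set L \<subseteq> {..<n}"
  shows "sum_exp (p # L) f
       = measure_pmf.expectation (X p) (\<lambda>x. sum_exp L (\<lambda>s. f (x + s)))"
  using assms
  by (simp add: expectation_bind_pmf_finite finite_weight_sum finite_supp)

text \<open>
  The maximum only serves termination: positive groups have weight at least 1.
\<close>

function dp :: "(nat \<Rightarrow> nat) \<Rightarrow> nat \<Rightarrow> real" where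
  "dp m w = (if w = 0 then 0 else
     MIN p\<in>{..<n}. real (m p) * c p + sum_exp (replicate (m p) p) (\<lambda>s. dp m (w - max 1 s)))"
  by auto
termination by (relation "Wellfounded.measure snd") auto

declare dp.simps [simp del]

lemma dp_0 [simp]: "dp m 0 = 0"
  by (simp add: dp.simps)

text \<open>The term minimised in the recursion for \<open>dp\<close>, freed of
  \<open>max 1\<close>; the two agree for positive group sizes.\<close>

definition group_cost :: "(nat \<Rightarrow> nat) \<Rightarrow> nat \<Rightarrow> nat \<Rightarrow> real" where
  "group_cost m w p = real (m p) * c p + sum_exp (replicate (m p) p) (\<lambda>s. dp m (w - s))"

lemma dp_eq_Min:
  assumes m: "\<And>p. p < n \<Longrightarrow> m p > 0" and w: "w > 0"
  shows "dp m w = Min (group_cost m w ` {..<n})"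
proof -
  have "sum_exp (replicate (m p) p) (\<lambda>s. dp m (w - max 1 s))
      = sum_exp (replicate (m p) p) (\<lambda>s. dp m (w - s))" if "p < n" for p
  proof (rule expectation_cong_pmf)
    fix s assume "s \<in> set_pmf (weight_sum X (replicate (m p) p))"
    with weight_sum_ge_length[of "replicate (m p) p" s] m[OF that] that have "1 \<le> s" by auto
    then show "dp m (w - max 1 s) = dp m (w - s)" by (simp add: max_def)
  qed
  then show ?thesis
    using w by (subst dp.simps) (auto simp: group_cost_def intro!: arg_cong[where f = Min] image_cong)
qed

lemma dp_le:
  assumes "\<And>p. p < n \<Longrightarrow> m p > 0" "p < n"
  shows "dp m w \<le> group_cost m w p"
proof (cases "w = 0")
  \<comment> \<open>Truncated subtraction makes the future cost \<open>dp m 0\<close>, so only the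
    nonnegative price of the group remains.\<close>
  case True
  then show ?thesis using c_pos[OF assms(2)] by (simp add: group_cost_def)
next
  case False
  then show ?thesis using assms by (subst dp_eq_Min) auto
qed

lemma dp_attained:
  assumes "\<And>p. p < n \<Longrightarrow> m p > 0" "w > 0"
  shows "\<exists>p<n. dp m w = group_cost m w p"
proof -
  have "Min (group_cost m w ` {..<n}) \<in> group_cost m w ` {..<n}"
    using n_pos by (intro Min_in) (auto simp: lessThan_empty_iff)
  then show ?thesis using assms by (subst dp_eq_Min) auto
qed

section \<open>Comparison of the one-item and the grouped dynamic programs\<close>

abbreviation dp1 :: "nat \<Rightarrow> real" where
  "dp1 \<equiv> dp (\<lambda>_. 1)"

lemma group_cost_1:
  "p < n \<Longrightarrow> group_cost (\<lambda>_. 1) w p = c p + measure_pmf.expectation (X p) (\<lambda>x. dp1 (w - x))"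
  using sum_exp_Cons[of p "[]" "\<lambda>s. dp1 (w - s)"] by (simp add: group_cost_def)

text \<open>Committing to \<open>k\<close> items in advance is one way of making \<open>k\<close>
  single choices, so the one-item inequality is iterated. Truncated subtraction covers groups that
  pass the target midway: \<open>dp1 0 = 0\<close>, and further items only add cost.\<close>

lemma dp1_le_group:
  assumes p: "p < n"
  shows "dp1 w \<le> real k * c p + sum_exp (replicate k p) (\<lambda>s. dp1 (w - s))"
proof (induction k arbitrary: w)
  case (Suc k)
  have "dp1 w \<le> c p + measure_pmf.expectation (X p) (\<lambda>x. dp1 (w - x))"
    using dp_le[of "\<lambda>_. 1" p w] group_cost_1 p by simp
  also have "\<dots> \<le> c p + measure_pmf.expectation (X p)
      (\<lambda>x. real k * c p + sum_exp (replicate k p) (\<lambda>s. dp1 (w - x - s)))"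
    using Suc.IH finite_supp[OF p] by (intro add_left_mono expectation_mono_finite)
  also have "\<dots> = real (Suc k) * c p + sum_exp (replicate (Suc k) p) (\<lambda>s. dp1 (w - s))"
  proof -
    have "sum_exp (replicate (Suc k) p) (\<lambda>s. dp1 (w - s))
        = measure_pmf.expectation (X p) (\<lambda>x. sum_exp (replicate k p) (\<lambda>s. dp1 (w - x - s)))"
      using p by (simp only: replicate_Suc, subst sum_exp_Cons) auto
    then show ?thesis
      by (simp only: expectation_add_const_finite[OF finite_supp[OF p]]) (simp add: algebra_simps)
  qed
  finally show ?case .
qed simp

lemma dp_le_dp1:
  assumes e: "\<And>p. p < n \<Longrightarrow> e p > 0"
    and L: "set L \<subseteq> {..<n}" "\<And>p. p < n \<Longrightarrow> count_list L p < e p"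
  shows "sum_exp L (\<lambda>s. dp e (w - s))
       \<le> dp1 w + (\<Sum>p<n. (real (e p) - 1 - real (count_list L p)) * c p)"
  using L
proof (induction w arbitrary: L rule: less_induct)
  case (less w)
  let ?slack = "\<lambda>L. \<Sum>p<n. (real (e p) - 1 - real (count_list L p)) * c p"
  show ?case
  proof (cases "w = 0")
    case True
    have "0 \<le> ?slack L"
      using less.prems(2) c_pos by (intro sum_nonneg mult_nonneg_nonneg) (force simp: less_imp_le)+
    then show ?thesis using True by simp
  next
    case False
    then obtain p where p: "p < n" and dp1: "dp1 w = group_cost (\<lambda>_. 1) w p"
      using dp_attained[of "\<lambda>_. 1" w] by auto
    have step: "sum_exp (p # K) (\<lambda>s. dp e (w - s)) \<le> dp1 w - c p + ?slack K"
      if K: "set K \<subseteq> {..<n}" "\<And>q. q < n \<Longrightarrow> count_list K q < e q" for K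
    proof -
      have "sum_exp (p # K) (\<lambda>s. dp e (w - s))
          = measure_pmf.expectation (X p) (\<lambda>x. sum_exp K (\<lambda>s. dp e (w - x - s)))"
        using p K(1) by (subst sum_exp_Cons) auto
      also have "\<dots> \<le> measure_pmf.expectation (X p) (\<lambda>x. ?slack K + dp1 (w - x))"
      proof (rule expectation_mono_finite[OF finite_supp[OF p]])
        fix x assume "x \<in> set_pmf (X p)"
        \<comment> \<open>Weights are at least 1, so the simulated remaining weight strictly
          drops.\<close>
        then have "w - x < w" using supp[OF p] False by force
        from less.IH[OF this K]
        show "sum_exp K (\<lambda>s. dp e (w - x - s)) \<le> ?slack K + dp1 (w - x)" by simp
      qed
      also have "\<dots> = ?slack K + measure_pmf.expectation (X p) (\<lambda>x. dp1 (w - x))"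
        by (rule expectation_add_const_finite[OF finite_supp[OF p]])
      finally show ?thesis using dp1 group_cost_1[OF p] by simp
    qed
    have slack_eq: "?slack K = ?slack K' + real j * c p"
      if "\<And>q. count_list K' q = count_list K q + (if q = p then j else 0)" for K K' j
    proof -
      have "?slack K = (\<Sum>q<n. (real (e q) - 1 - real (count_list K' q)) * c q
          + (if q = p then real j * c p else 0))"
        by (rule sum.cong) (auto simp: that algebra_simps)
      then show ?thesis using p by (simp add: sum.distrib)
    qed
    show ?thesis
    proof (cases "p \<in> set L")
      case True
      let ?K = "remove1 p L"
      have eq: "count_list L q = count_list ?K q + (if q = p then 1 else 0)" for q
        using True by (induction L) auto
      have "count_list ?K q \<le> count_list L q" for q
        unfolding eq[of q] by (rule le_add1)
      then have K: "set ?K \<subseteq> {..<n}" "\<And>q. q < n \<Longrightarrow> count_list ?K q < e q"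
        using less.prems set_remove1_subset[of p L] by (blast, meson le_less_trans)
      have "?slack ?K = ?slack L + c p"
        using slack_eq[OF eq] by simp
      then show ?thesis
        using step[OF K] unfolding weight_sum_remove1[OF True, of X] by simp
    next
      case False
      \<comment> \<open>A new group is bought: one item is used at once and \<open>e p - 1\<close>
        are stored. Since \<open>L\<close> holds none of type \<open>p\<close>, the bound on counts
        survives.\<close>
      let ?K = "replicate (e p - 1) p @ L"
      have count_rep: "count_list (replicate k p) q = (if q = p then k else 0)" for k q
        by (induction k) auto
      have eq: "count_list ?K q = count_list L q + (if q = p then e p - 1 else 0)" for q
        by (simp add: count_rep)
      have zero: "count_list L p = 0" using False by (simp add: count_list_0_iff)
      have K: "set ?K \<subseteq> {..<n}" "\<And>q. q < n \<Longrightarrow> count_list ?K q < e q"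
        using less.prems p e[OF p] zero by (auto simp: count_rep)
      \<comment> \<open>The type \<open>p\<close> depends on \<open>w\<close> only, not on the
        hidden total \<open>s\<close>, so the same group is bought for every \<open>s\<close>, even
        if \<open>w - s = 0\<close>.\<close>
      have "sum_exp L (\<lambda>s. dp e (w - s))
          \<le> sum_exp L (\<lambda>s. real (e p) * c p + sum_exp (replicate (e p) p) (\<lambda>s'. dp e (w - (s + s'))))"
      proof (rule expectation_mono_finite[OF finite_weight_sum[OF less.prems(1)]])
        fix s
        show "dp e (w - s)
            \<le> real (e p) * c p + sum_exp (replicate (e p) p) (\<lambda>s'. dp e (w - (s + s')))"
          using dp_le[of e p "w - s"] e p by (simp add: group_cost_def)
      qed
      also have "\<dots> = real (e p) * c p + sum_exp (L @ replicate (e p) p) (\<lambda>s. dp e (w - s))"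
        using less.prems(1) p
        by (subst expectation_add_const_finite)
          (auto simp: finite_weight_sum sum_exp_append set_replicate_conv_if)
      also have "sum_exp (L @ replicate (e p) p) (\<lambda>s. dp e (w - s))
          = sum_exp (p # ?K) (\<lambda>s. dp e (w - s))"
      proof -
        have "weight_sum X (L @ replicate (e p) p) = weight_sum X (replicate (e p) p @ L)"
          unfolding weight_sum_append map_pmf_def
          by (subst bind_commute_pmf) (simp add: add.commute)
        also have "replicate (e p) p @ L = p # ?K"
          using e[OF p] by (cases "e p") auto
        finally show ?thesis by simp
      qed
      also have "\<dots> \<le> dp1 w - c p + ?slack ?K" by (rule step[OF K])
      finally show ?thesis
        \<comment> \<open>Paying \<open>e p * c p\<close>, less the simulated price
          \<open>c p\<close>, is balanced by the slack dropping by
          \<open>(e p - 1) * c p\<close>.\<close>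
        using slack_eq[OF eq] e[OF p] by (simp add: of_nat_diff algebra_simps)
    qed
  qed
qed

section \<open>Runs of strategies and the cost potential\<close>

lemma finite_insert_items:
  "p < n \<Longrightarrow> finite (set_pmf (insert_items X h (p, m)))"
  by (simp add: insert_items_def finite_set_replicate_pmf finite_supp)

lemma finite_run:
  assumes "\<And>h. \<exists>p<n. \<exists>m. \<sigma> h = (p, m)"
  shows "finite (set_pmf (run W X \<sigma> t))"
proof (induction t)
  case (Suc t)
  have "finite (set_pmf (insert_items X h (\<sigma> h)))" for h
    using assms[of h] finite_insert_items by metis
  then show ?case using Suc by auto
qed simp

text \<open>One-step change of the potential "cost so far plus estimated cost to go". The estimate
  \<open>f\<close> stays arbitrary, to be taken as \<open>dp1\<close> for the lower bound and as
  \<open>dp m\<close> for attainment.\<close>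

lemma expectation_insert_items:
  assumes p: "p < n"
  shows "measure_pmf.expectation (insert_items X h (p, m))
           (\<lambda>h. total_cost c h + f (W - total_weight h))
       = total_cost c h + (real m * c p
         + sum_exp (replicate m p) (\<lambda>s. f (W - total_weight h - s)))"
proof -
  have fin: "finite (set_pmf (replicate_pmf m (X p)))"
    using p by (intro finite_set_replicate_pmf finite_supp)
  have "measure_pmf.expectation (insert_items X h (p, m))
           (\<lambda>h. total_cost c h + f (W - total_weight h))
      = measure_pmf.expectation (replicate_pmf m (X p))
          (\<lambda>ws. (total_cost c h + real m * c p) + f (W - total_weight h - sum_list ws))"
    unfolding insert_items_def
    by (auto simp: total_cost_def total_weight_def o_def sum_list_triv set_replicate_pmf
        intro!: expectation_cong_pmf)
  also have "\<dots> = total_cost c h + (real m * c p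
         + sum_exp (replicate m p) (\<lambda>s. f (W - total_weight h - s)))"
    by (simp add: expectation_add_const_finite[OF fin] weight_sum_replicate)
  finally show ?thesis .
qed

lemma expectation_run_Suc:
  fixes f :: "history \<Rightarrow> real"
  assumes \<sigma>: "\<And>h. \<exists>p<n. \<exists>m. \<sigma> h = (p, m)"
  shows "measure_pmf.expectation (run W X \<sigma> (Suc t)) f
       = measure_pmf.expectation (run W X \<sigma> t) (\<lambda>h. if W \<le> total_weight h then f h
           else measure_pmf.expectation (insert_items X h (\<sigma> h)) f)"
proof -
  have fin: "finite (set_pmf (insert_items X h (\<sigma> h)))" for h
    using \<sigma>[of h] finite_insert_items by metis
  have "measure_pmf.expectation (run W X \<sigma> (Suc t)) f
      = measure_pmf.expectation (run W X \<sigma> t) (\<lambda>h. measure_pmf.expectation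
          (if W \<le> total_weight h then return_pmf h else insert_items X h (\<sigma> h)) f)"
    unfolding run.simps
    by (intro expectation_bind_pmf_finite finite_run[of \<sigma> t, OF \<sigma>]) (simp add: fin)
  also have "\<dots> = measure_pmf.expectation (run W X \<sigma> t) (\<lambda>h. if W \<le> total_weight h then f h
      else measure_pmf.expectation (insert_items X h (\<sigma> h)) f)"
    by (rule expectation_cong_pmf) simp
  finally show ?thesis .
qed

text \<open>After \<open>W\<close> decisions the target is reached, so the estimate contributes only
  \<open>f 0\<close>.\<close>

lemma expected_cost_eq_potential:
  assumes \<sigma>: "\<And>h. \<exists>p<n. \<exists>m>0. \<sigma> h = (p, m)" and "f 0 = 0"
  shows "expected_cost W c X \<sigma> = measure_pmf.expectation (run W X \<sigma> W)
           (\<lambda>h. total_cost c h + f (W - total_weight h))"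
  unfolding expected_cost_def
  using run_finished[of n X W \<sigma>] supp \<sigma> assms(2)
  by (intro expectation_cong_pmf) auto

text \<open>By \<open>dp1_le_group\<close> the potential with \<open>dp1\<close> never decreases in
  expectation, and it starts at \<open>dp1 W\<close>. Arbitrary positive groups are allowed, so that
  item and block strategies are both covered.\<close>

lemma dp1_le_expected_cost:
  assumes \<sigma>: "\<And>h. \<exists>p<n. \<exists>m>0. \<sigma> h = (p, m)"
  shows "dp1 W \<le> expected_cost W c X \<sigma>"
proof -
  let ?F = "\<lambda>h. total_cost c h + dp1 (W - total_weight h)"
  have \<sigma>': "\<exists>p<n. \<exists>m. \<sigma> h = (p, m)" for h using \<sigma> by blast
  have "dp1 W \<le> measure_pmf.expectation (run W X \<sigma> t) ?F" for t
  proof (induction t)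
    case (Suc t)
    have "?F h \<le> measure_pmf.expectation (insert_items X h (\<sigma> h)) ?F" for h
    proof -
      obtain p m where pm: "p < n" "\<sigma> h = (p, m)" using \<sigma>' by blast
      show ?thesis
        unfolding pm(2) expectation_insert_items[OF pm(1)]
        by (intro add_left_mono dp1_le_group[OF pm(1)])
    qed
    then have "measure_pmf.expectation (run W X \<sigma> t) ?F
        \<le> measure_pmf.expectation (run W X \<sigma> (Suc t)) ?F"
      unfolding expectation_run_Suc[of \<sigma>, OF \<sigma>']
      by (intro expectation_mono_finite finite_run[of \<sigma>, OF \<sigma>']) auto
    then show ?case using Suc by linarith
  qed (simp add: total_cost_def total_weight_def)
  then show ?thesis using expected_cost_eq_potential[of \<sigma> dp1, OF \<sigma>] by simp
qed

text \<open>Always following a minimiser of the recursion keeps the expected potential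
  constant.\<close>

lemma dp_achieved:
  assumes m: "\<And>p. p < n \<Longrightarrow> m p > 0"
  obtains \<sigma> where "\<And>h. \<exists>p<n. \<sigma> h = (p, m p)" "expected_cost W c X \<sigma> = dp m W"
proof -
  \<comment> \<open>At \<open>w = 0\<close> no minimiser is required, but a valid type is: type 0
    exists because \<open>n \<ge> 1\<close>.\<close>
  have "\<exists>p<n. w > 0 \<longrightarrow> dp m w = group_cost m w p" for w
    using dp_attained[of m w, OF m] n_pos by (cases "w = 0") (auto intro: exI[of _ 0])
  then obtain best where best: "\<And>w. best w < n"
      "\<And>w. w > 0 \<Longrightarrow> dp m w = group_cost m w (best w)"
    by metis
  define \<sigma> where "\<sigma> h = (best (W - total_weight h), m (best (W - total_weight h)))" for h
  have ex: "\<exists>p<n. \<sigma> h = (p, m p)" for h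
    using best(1) by (auto simp: \<sigma>_def)
  then have \<sigma>: "\<exists>p<n. \<exists>k>0. \<sigma> h = (p, k)" and \<sigma>': "\<exists>p<n. \<exists>k. \<sigma> h = (p, k)" for h
    using m by blast+
  let ?F = "\<lambda>h. total_cost c h + dp m (W - total_weight h)"
  have "measure_pmf.expectation (run W X \<sigma> t) ?F = dp m W" for t
  proof (induction t)
    case (Suc t)
    have "measure_pmf.expectation (insert_items X h (\<sigma> h)) ?F = ?F h"
      if "\<not> W \<le> total_weight h" for h
      unfolding \<sigma>_def expectation_insert_items[OF best(1)]
      using best(2)[of "W - total_weight h"] that by (simp add: group_cost_def)
    then have "measure_pmf.expectation (run W X \<sigma> (Suc t)) ?F
        = measure_pmf.expectation (run W X \<sigma> t) ?F"
      unfolding expectation_run_Suc[of \<sigma>, OF \<sigma>'] by (intro expectation_cong_pmf) auto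
    then show ?case using Suc by simp
  qed (simp add: total_cost_def total_weight_def)
  then have "expected_cost W c X \<sigma> = dp m W"
    using expected_cost_eq_potential[of \<sigma> "dp m", OF \<sigma>] by simp
  with ex show ?thesis by (rule that)
qed

section \<open>The two optima in terms of the dynamic programs\<close>

lemma OPT_eq_dp1: "OPT n W c X = dp1 W"
proof (rule antisym)
  \<comment> \<open>Serves twice: it bounds the set of costs below, as \<open>cINF_lower\<close>
    requires, and it bounds the infimum.\<close>
  have lower: "dp1 W \<le> expected_cost W c X \<sigma>" if "\<sigma> \<in> item_strategies n" for \<sigma>
    using that by (intro dp1_le_expected_cost) (fastforce simp: item_strategies_def)
  obtain \<sigma> where \<sigma>: "\<And>h. \<exists>p<n. \<sigma> h = (p, 1)" "expected_cost W c X \<sigma> = dp1 W"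
    using dp_achieved[of "\<lambda>_. 1"] by auto
  then have mem: "\<sigma> \<in> item_strategies n" by (simp add: item_strategies_def)
  show "OPT n W c X \<le> dp1 W"
    unfolding OPT_def \<sigma>(2)[symmetric] using lower mem by (intro cINF_lower bdd_belowI2)
  show "dp1 W \<le> OPT n W c X"
    unfolding OPT_def using lower mem by (intro cINF_greatest) auto
qed

text \<open>The lower bound treats every multiple of \<open>e p\<close> as a group; for the upper
  bound, groups of exactly \<open>e p\<close> suffice.\<close>

lemma block_OPT_bounds:
  assumes e: "\<And>p. p < n \<Longrightarrow> e p > 0"
  shows "dp1 W \<le> block_OPT n W c X e" "block_OPT n W c X e \<le> dp e W"
proof -
  have lower: "dp1 W \<le> expected_cost W c X \<sigma>" if block: "\<sigma> \<in> block_strategies n e" for \<sigma>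
  proof (rule dp1_le_expected_cost)
    fix h
    obtain p k where "p < n" "k > 0" "\<sigma> h = (p, k * e p)"
      using block unfolding block_strategies_def by blast
    then show "\<exists>p<n. \<exists>m>0. \<sigma> h = (p, m)" using e[of p] by auto
  qed
  obtain \<sigma> where \<sigma>: "\<And>h. \<exists>p<n. \<sigma> h = (p, e p)" "expected_cost W c X \<sigma> = dp e W"
    using dp_achieved[of e, OF e] by metis
  have mem: "\<sigma> \<in> block_strategies n e"
    unfolding block_strategies_def
  proof (intro CollectI allI)
    fix h
    obtain p where "p < n" "\<sigma> h = (p, 1 * e p)"
      using \<sigma>(1)[of h] by (metis mult_1)
    then show "\<exists>p<n. \<exists>k>0. \<sigma> h = (p, k * e p)" using zero_less_one by blast
  qed
  show "block_OPT n W c X e \<le> dp e W"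
    unfolding block_OPT_def \<sigma>(2)[symmetric] using lower mem by (intro cINF_lower bdd_belowI2)
  show "dp1 W \<le> block_OPT n W c X e"
    unfolding block_OPT_def using lower mem by (intro cINF_greatest) auto
qed

lemma block_OPT_le:
  assumes "\<And>p. p < n \<Longrightarrow> e p > 0"
  shows "block_OPT n W c X e \<le> OPT n W c X + (\<Sum>p<n. (real (e p) - 1) * c p)"
  using block_OPT_bounds(2)[of e] dp_le_dp1[of e "[]" W] assms by (fastforce simp: OPT_eq_dp1)

section \<open>The constant \<open>T_val\<close> and the final estimate\<close>

lemma T_val_nonneg: "0 \<le> T_val n W c X"
proof -
  have "0 \<le> c i / Ebar W (X i)" if "i < n" for i
    using c_pos[OF that] unfolding Ebar_def
    by (intro divide_nonneg_nonneg sum_nonneg) auto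
  then have "0 \<le> (MIN i\<in>{..<n}. c i / Ebar W (X i))"
    using n_pos by (subst Min_ge_iff) (auto simp: lessThan_empty_iff)
  then show ?thesis by (simp add: T_val_def)
qed

end

theorem theorem2:
  fixes n W :: nat and \<epsilon> :: real
    and c :: "nat \<Rightarrow> real" and X :: "nat \<Rightarrow> nat pmf" and e :: "nat \<Rightarrow> nat"
  assumes "n \<ge> 1" and "W \<ge> 1" and "0 < \<epsilon>" and "\<epsilon> < 1"
    and "\<And>i. i < n \<Longrightarrow> c i > 0"
    and "\<And>i. i < n \<Longrightarrow> set_pmf (X i) \<subseteq> {1..W}"
    and "valid_block_sizes n W \<epsilon> c X e"
  shows "OPT n W c X \<le> block_OPT n W c X e
       \<and> block_OPT n W c X e \<le> OPT n W c X + \<epsilon> * T_val n W c X / 5"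
proof -
  interpret min_knapsack n W c X
    using assms by unfold_locales auto
  let ?b = "theta n \<epsilon> * T_val n W c X"
  have b: "0 \<le> ?b" using T_val_nonneg assms(3) by (simp add: theta_def)
  have sizes: "e p > 0 \<and> (real (e p) - 1) * c p \<le> 2 * ?b" if p: "p < n" for p
  proof (cases "c p \<ge> ?b")
    case True
    then have "e p = 1" using assms(7) p by (simp add: valid_block_sizes_def Let_def)
    then show ?thesis using b by simp
  next
    case False
    then obtain k :: int where k: "real (e p) = 2 powi k" and "real (e p) * c p \<le> 2 * ?b"
      using assms(7) p by (fastforce simp: valid_block_sizes_def Let_def)
    \<comment> \<open>A power of two with integer exponent is positive, which rules out an empty
      group.\<close>
    moreover have "0 < real (e p)" unfolding k by simp
    then have "0 < e p" by simp
    ultimately show ?thesis using c_pos[OF p] by (simp add: algebra_simps)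
  qed
  have "(\<Sum>p<n. (real (e p) - 1) * c p) \<le> (\<Sum>p<n. 2 * ?b)"
    using sizes by (intro sum_mono) auto
  \<comment> \<open>The \<open>n\<close> types together give
    \<open>2 * n * theta n \<epsilon> = \<epsilon> / 5\<close> times \<open>T_val\<close>.\<close>
  also have "\<dots> = \<epsilon> * T_val n W c X / 5"
    using assms(1) by (simp add: theta_def)
  finally show ?thesis
    using block_OPT_le[of e] block_OPT_bounds(1)[of e] sizes OPT_eq_dp1 by force
qed

end
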